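(* There is an infinite set $S$ of integers such that for every $m \in S$, $n_m \le 0.4643\,(m-2)^{m-2}$.
   Context: For a graph $G$, a $k$-list assignment $L$ assigns to each vertex $v$ a set $L(v)$ of exactly $k$ colors; a proper $L$-coloring chooses $c(v)\in L(v)$ for each $v$ with adjacent vertices receiving different colors. The choice number $ch(G)$ is the least $k$ such that for every $k$-list assignment $L$ of $G$ there is a proper $L$-coloring. $K_{m,n}$ denotes the complete bipartite graph with parts of sizes $m$ and $n$. For an integer $m\ge 3$, $n_m$ denotes the smallest positive integer $n$ such that $ch(K_{m,n}) = m-1$. *)

theory Defs
  imports Complex_Main
begin

text \<open>
  A graph is given by a vertex set and a symmetric, irreflexive adjacency relation.
  Colors are natural numbers; as there are infinitely many of them, any list assignment of a
  finite graph with finite lists can be renamed into this type.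
\<close>

record 'v graph =
  verts :: "'v set"
  adj :: "'v \<Rightarrow> 'v \<Rightarrow> bool"

definition simple_graph :: "'v graph \<Rightarrow> bool" where
  "simple_graph G \<longleftrightarrow> (\<forall>u\<in>verts G. \<not> adj G u u) \<and>
     (\<forall>u\<in>verts G. \<forall>v\<in>verts G. adj G u v \<longrightarrow> adj G v u)"

definition list_assignment :: "'v graph \<Rightarrow> nat \<Rightarrow> ('v \<Rightarrow> nat set) \<Rightarrow> bool" where
  "list_assignment G k L \<longleftrightarrow> (\<forall>v\<in>verts G. finite (L v) \<and> card (L v) = k)"

definition proper_list_coloring :: "'v graph \<Rightarrow> ('v \<Rightarrow> nat set) \<Rightarrow> ('v \<Rightarrow> nat) \<Rightarrow> bool" where
  "proper_list_coloring G L c \<longleftrightarrow> (\<forall>v\<in>verts G. c v \<in> L v) \<and>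
     (\<forall>u\<in>verts G. \<forall>v\<in>verts G. adj G u v \<longrightarrow> c u \<noteq> c v)"

definition choosable :: "'v graph \<Rightarrow> nat \<Rightarrow> bool" where
  "choosable G k \<longleftrightarrow> (\<forall>L. list_assignment G k L \<longrightarrow> (\<exists>c. proper_list_coloring G L c))"

definition choice_number :: "'v graph \<Rightarrow> nat" where
  "choice_number G = (LEAST k. choosable G k)"

definition complete_bipartite :: "nat \<Rightarrow> nat \<Rightarrow> (nat + nat) graph" where
  "complete_bipartite m n =
     \<lparr> verts = {..<m} <+> {..<n}, adj = (\<lambda>u v. isl u \<noteq> isl v) \<rparr>"

lemma simple_graph_complete_bipartite: "simple_graph (complete_bipartite m n)"
  by (auto simp: simple_graph_def complete_bipartite_def)

text \<open>
  For \<open>m \<ge> 3\<close> the minimum below is over a nonempty set: \<open>K\<^sub>m\<^sub>,\<^sub>1\<close> has choice number 2, an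
  additional vertex raises the choice number by at most 1, and the choice number is \<open>m + 1\<close>
  for \<open>n \<ge> m ^ m\<close>.
\<close>

definition n_min :: "nat \<Rightarrow> nat" where
  "n_min m = (LEAST n. 0 < n \<and> choice_number (complete_bipartite m n) = m - 1)"

end

theory Submission
  imports Defs "HOL-Library.FuncSet" "HOL-Library.Nat_Bijection" "HOL-Real_Asymp.Real_Asymp"
begin

text \<open>
  Put \<open>k = m - 2\<close>. Give \<open>k\<close> vertices of the \<open>m\<close>-side pairwise disjoint lists \<open>M\<^sub>1, \<dots>, M\<^sub>k\<close> of size
  \<open>k\<close>, pick distinct \<open>x\<^sub>i, y\<^sub>i \<in> M\<^sub>i\<close>, and give the two remaining vertices the lists
  \<open>{x\<^sub>1, \<dots>, x\<^sub>k}\<close> and \<open>{y\<^sub>1, \<dots>, y\<^sub>k}\<close>. If these two use \<open>x\<^sub>i\<close> and \<open>y\<^sub>j\<close>, then the set of all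
  colors used on this side contains a transversal of the \<open>M\<^sub>l\<close> with at least one \<open>x\<close> and at least
  one \<open>y\<close>, unless \<open>i = j\<close> and the colors outside \<open>M\<^sub>i\<close> are neither \<open>x\<close>s nor \<open>y\<close>s. In that case it
  contains \<open>x\<^sub>i\<close>, \<open>y\<^sub>i\<close> and \<open>k - 2\<close> such colors. Using all these \<open>k\<close>-sets as lists on the other
  side rules out a coloring, and their number is at most
  \<open>k\<^sup>k - 2 (k - 1)\<^sup>k + (k - 2)\<^sup>k + k (k - 2)\<^bsup>k - 2\<^esup>\<close>, which is asymptotic to \<open>(1 - 1/e)\<^sup>2 k\<^sup>k\<close>
  with \<open>(1 - 1/e)\<^sup>2 < 0.4\<close>.
\<close>

section \<open>Choosability of complete bipartite graphs\<close>

lemma choosable_mono: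
  assumes "choosable G k" "k \<le> k'"
  shows "choosable G k'"
  unfolding choosable_def
proof (intro allI impI)
  fix L assume L: "list_assignment G k' L"
  have "\<forall>v\<in>verts G. \<exists>T. T \<subseteq> L v \<and> finite T \<and> card T = k"
    using L assms(2) by (auto simp: list_assignment_def) (metis obtain_subset_with_card_n)
  then obtain L' where L': "\<And>v. v \<in> verts G \<Longrightarrow> L' v \<subseteq> L v \<and> finite (L' v) \<and> card (L' v) = k"
    by metis
  then have "list_assignment G k L'"
    by (auto simp: list_assignment_def)
  then obtain c where "proper_list_coloring G L' c"
    using assms(1) by (auto simp: choosable_def)
  then have "proper_list_coloring G L c"
    using L' by (fastforce simp: proper_list_coloring_def)
  then show "\<exists>c. proper_list_coloring G L c" by blast
qed

lemma verts_complete_bipartite [simp]: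
  "v \<in> verts (complete_bipartite m n) \<longleftrightarrow> (case v of Inl i \<Rightarrow> i < m | Inr j \<Rightarrow> j < n)"
  by (cases v) (auto simp: complete_bipartite_def)

lemma proper_list_coloring_complete_bipartite:
  "proper_list_coloring (complete_bipartite m n) L c \<longleftrightarrow>
     (\<forall>i<m. c (Inl i) \<in> L (Inl i)) \<and> (\<forall>j<n. c (Inr j) \<in> L (Inr j)) \<and>
     (\<forall>i<m. \<forall>j<n. c (Inl i) \<noteq> c (Inr j))"
proof -
  have "adj (complete_bipartite m n) = (\<lambda>u v. isl u \<noteq> isl v)"
    by (simp add: complete_bipartite_def)
  then show ?thesis
    unfolding proper_list_coloring_def Ball_def verts_complete_bipartite split_sum_all
    by (auto simp: eq_commute)
qed

lemma list_assignment_complete_bipartite: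
  "list_assignment (complete_bipartite m n) k L \<longleftrightarrow>
     (\<forall>i<m. finite (L (Inl i)) \<and> card (L (Inl i)) = k) \<and>
     (\<forall>j<n. finite (L (Inr j)) \<and> card (L (Inr j)) = k)"
  unfolding list_assignment_def Ball_def verts_complete_bipartite split_sum_all by simp

lemma choosable_complete_bipartite_0:
  assumes "k > 0"
  shows "choosable (complete_bipartite m 0) k"
  unfolding choosable_def
proof (intro allI impI)
  fix L assume L: "list_assignment (complete_bipartite m 0) k L"
  define c where "c v = (SOME a. a \<in> L v)" for v :: "nat + nat"
  have "c (Inl i) \<in> L (Inl i)" if "i < m" for i
  proof -
    have "L (Inl i) \<noteq> {}"
      using L assms that by (auto simp: list_assignment_complete_bipartite)
    then show ?thesis
      unfolding c_def by (simp add: some_in_eq)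
  qed
  then have "proper_list_coloring (complete_bipartite m 0) L c"
    by (simp add: proper_list_coloring_complete_bipartite)
  then show "\<exists>c. proper_list_coloring (complete_bipartite m 0) L c" by blast
qed

text \<open>Reserve a color \<open>a\<close> from the list of the new vertex and delete it from all
  other lists, each of which loses at most one color. The left side then avoids \<open>a\<close>, so
  \<open>a\<close> is free for the new vertex.\<close>

lemma choosable_complete_bipartite_Suc:
  assumes "choosable (complete_bipartite m n) k"
  shows "choosable (complete_bipartite m (Suc n)) (Suc k)"
  unfolding choosable_def
proof (intro allI impI)
  fix L assume L: "list_assignment (complete_bipartite m (Suc n)) (Suc k) L"
  then obtain a where a: "a \<in> L (Inr n)"
    by (fastforce simp: list_assignment_complete_bipartite)
  have "\<exists>T. T \<subseteq> L v - {a} \<and> finite T \<and> card T = k"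
    if "v \<in> verts (complete_bipartite m n)" for v
  proof -
    have "finite (L v)" "card (L v) = Suc k"
      using L that by (cases v; simp add: list_assignment_complete_bipartite)+
    then have "k \<le> card (L v - {a})"
      by (auto simp: card_Diff_singleton_if)
    then show ?thesis
      by (metis obtain_subset_with_card_n)
  qed
  then obtain L' where L': "\<And>v. v \<in> verts (complete_bipartite m n) \<Longrightarrow>
      L' v \<subseteq> L v - {a} \<and> finite (L' v) \<and> card (L' v) = k"
    by metis
  then have "list_assignment (complete_bipartite m n) k L'"
    by (auto simp: list_assignment_def)
  then obtain c where c: "proper_list_coloring (complete_bipartite m n) L' c"
    using assms by (auto simp: choosable_def)
  have "c (Inl i) \<in> L (Inl i) - {a}" if "i < m" for i
    using c L'[of "Inl i"] that by (auto simp: proper_list_coloring_complete_bipartite)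
  moreover have "c (Inr j) \<in> L (Inr j)" if "j < n" for j
    using c L'[of "Inr j"] that by (auto simp: proper_list_coloring_complete_bipartite)
  ultimately have "proper_list_coloring (complete_bipartite m (Suc n)) L (c(Inr n := a))"
    using a c by (auto simp: proper_list_coloring_complete_bipartite less_Suc_eq)
  then show "\<exists>c. proper_list_coloring (complete_bipartite m (Suc n)) L c" by blast
qed

text \<open>It suffices to refute \<open>m - 2\<close>-choosability: at the least \<open>n\<close>
  where it fails, \<open>n - 1\<close> still succeeds, so one more vertex gives choice number
  exactly \<open>m - 1\<close>.\<close>

lemma n_min_le:
  assumes "3 \<le> m" "\<not> choosable (complete_bipartite m N) (m - 2)"
  shows "n_min m \<le> N"
proof -
  define n where "n = (LEAST n. \<not> choosable (complete_bipartite m n) (m - 2))"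
  have not: "\<not> choosable (complete_bipartite m n) (m - 2)"
    unfolding n_def by (rule LeastI) (rule assms(2))
  have "n \<le> N"
    unfolding n_def by (rule Least_le) (rule assms(2))
  \<comment> \<open>Lists are nonempty since \<open>m - 2 > 0\<close>, so the edgeless case
    \<open>n = 0\<close> is choosable.\<close>
  have "n > 0"
    using not choosable_complete_bipartite_0[of "m - 2" m] assms(1) by (cases n) auto
  have "choosable (complete_bipartite m (n - 1)) (m - 2)"
    using not_less_Least[of "n - 1" "\<lambda>n. \<not> choosable (complete_bipartite m n) (m - 2)"] \<open>n > 0\<close>
    unfolding n_def by auto
  then have "choosable (complete_bipartite m n) (m - 1)"
    using choosable_complete_bipartite_Suc[of m "n - 1" "m - 2"] \<open>n > 0\<close> assms(1)
    by (simp add: Suc_diff_le numeral_eq_Suc Suc_diff_Suc)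
  then have "choice_number (complete_bipartite m n) = m - 1"
    unfolding choice_number_def
  proof (rule Least_equality)
    fix k assume "choosable (complete_bipartite m n) k"
    then show "m - 1 \<le> k"
      using not choosable_mono[of "complete_bipartite m n" k "m - 2"] by (cases "k \<le> m - 2") auto
  qed
  then have "n_min m \<le> n"
    unfolding n_min_def by (intro Least_le) (use \<open>n > 0\<close> in simp)
  with \<open>n \<le> N\<close> show ?thesis by simp
qed

text \<open>The members of \<open>F\<close> serve as the lists on the right. Some \<open>S\<close>
  in \<open>F\<close> consists of colors used on the left, so the vertex with list \<open>S\<close>
  has no color available.\<close>

lemma not_choosable_complete_bipartiteI:
  fixes A :: "nat \<Rightarrow> nat set"
  assumes "finite F" "\<And>S. S \<in> F \<Longrightarrow> finite S \<and> card S = k"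
    and "\<And>i. i < m \<Longrightarrow> finite (A i) \<and> card (A i) = k"
    and "\<And>f. (\<And>i. i < m \<Longrightarrow> f i \<in> A i) \<Longrightarrow> \<exists>S\<in>F. S \<subseteq> f ` {..<m}"
  shows "\<not> choosable (complete_bipartite m (card F)) k"
proof
  assume ch: "choosable (complete_bipartite m (card F)) k"
  obtain h where h: "bij_betw h {..<card F} F"
    using ex_bij_betw_nat_finite[OF assms(1)] by (auto simp: atLeast0LessThan)
  then have h_in: "h j \<in> F" if "j < card F" for j
    using that by (auto simp: bij_betw_def)
  have "list_assignment (complete_bipartite m (card F)) k (case_sum A h)"
    using assms h_in by (simp add: list_assignment_complete_bipartite)
  then obtain c where c: "proper_list_coloring (complete_bipartite m (card F)) (case_sum A h) c"
    using ch by (auto simp: choosable_def)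
  then obtain S where S: "S \<in> F" "S \<subseteq> (\<lambda>i. c (Inl i)) ` {..<m}"
    using assms(4)[of "\<lambda>i. c (Inl i)"] by (auto simp: proper_list_coloring_complete_bipartite)
  have "S \<in> h ` {..<card F}"
    using h S(1) by (simp add: bij_betw_def)
  then obtain j where j: "j < card F" "h j = S"
    by blast
  with c S(2) show False
    by (force simp: proper_list_coloring_complete_bipartite)
qed

section \<open>The lists on both sides\<close>

text \<open>The color \<open>color i t\<close> is the element number \<open>t\<close> of \<open>M\<^sub>i\<close>; \<open>x\<^sub>i\<close> is number 0, \<open>y\<^sub>i\<close> number 1.\<close>

definition color :: "nat \<Rightarrow> nat \<Rightarrow> nat" where
  "color i t = prod_encode (i, t)"

lemma color_eq_iff [simp]: "color i s = color j t \<longleftrightarrow> i = j \<and> s = t"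
  by (simp add: color_def)

definition left_list :: "nat \<Rightarrow> nat \<Rightarrow> nat set" where
  "left_list k i = (if i < k then color i ` {..<k} else (\<lambda>l. color l (i - k)) ` {..<k})"

definition mixed_words :: "nat \<Rightarrow> (nat \<Rightarrow> nat) set" where
  "mixed_words k = {z \<in> {..<k} \<rightarrow>\<^sub>E {..<k}. 0 \<in> z ` {..<k} \<and> 1 \<in> z ` {..<k}}"

definition mixed_sets :: "nat \<Rightarrow> nat set set" where
  "mixed_sets k = (\<lambda>z. (\<lambda>i. color i (z i)) ` {..<k}) ` mixed_words k"

text \<open>Besides \<open>i\<close> one further index is dropped, because the two colors taken from
  block \<open>i\<close> leave room for only \<open>k - 2\<close> others.\<close>

definition rest :: "nat \<Rightarrow> nat \<Rightarrow> nat set" where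
  "rest k i = {..<k} - {i, if i = 0 then 1 else 0}"

definition double_sets :: "nat \<Rightarrow> nat set set" where
  "double_sets k = (\<Union>i<k. (\<lambda>w. {color i 0, color i 1} \<union> (\<lambda>l. color l (w l)) ` rest k i) `
     (rest k i \<rightarrow>\<^sub>E {2..<k}))"

lemma card_left_list: "finite (left_list k i) \<and> card (left_list k i) = k"
  by (auto simp: left_list_def card_image inj_on_def)

section \<open>Sizes of the sets and of the families\<close>

lemma card_mixed_set:
  assumes "S \<in> mixed_sets k"
  shows "finite S \<and> card S = k"
  using assms by (auto simp: mixed_sets_def card_image inj_on_def)

lemma card_rest:
  assumes "2 \<le> k" "i < k"
  shows "card (rest k i) = k - 2"
  using assms by (auto simp: rest_def card_Diff_subset)

lemma card_double_set:
  assumes "2 \<le> k" "S \<in> double_sets k"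
  shows "finite S \<and> card S = k"
proof -
  from assms(2) obtain i w where i: "i < k"
    and S: "S = {color i 0, color i 1} \<union> (\<lambda>l. color l (w l)) ` rest k i"
    by (auto simp: double_sets_def)
  have fin: "finite (rest k i)" by (simp add: rest_def)
  have "i \<notin> rest k i" by (simp add: rest_def)
  then have "{color i 0, color i 1} \<inter> (\<lambda>l. color l (w l)) ` rest k i = {}"
    by auto
  then have "card S = card {color i 0, color i 1} + card ((\<lambda>l. color l (w l)) ` rest k i)"
    unfolding S using fin by (intro card_Un_disjoint) auto
  also have "\<dots> = 2 + (k - 2)"
    using card_rest[OF assms(1) i] by (simp add: card_image inj_on_def)
  finally show ?thesis
    using assms(1) fin S by simp
qed

lemma finite_mixed_words: "finite (mixed_words k)"
  unfolding mixed_words_def by (rule finite_subset[of _ "{..<k} \<rightarrow>\<^sub>E {..<k}"]) (auto intro: finite_PiE)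

text \<open>Inclusion-exclusion over the words that avoid 0 and those that avoid 1.\<close>

lemma card_mixed_words:
  assumes "2 \<le> k"
  shows "real (card (mixed_words k)) = real k ^ k - 2 * (real k - 1) ^ k + (real k - 2) ^ k"
proof -
  define W where "W T = {..<k} \<rightarrow>\<^sub>E T" for T :: "nat set"
  have fin: "finite (W T)" if "finite T" for T
    using that by (auto simp: W_def intro: finite_PiE)
  have card_W: "card (W T) = card T ^ k" for T
    by (simp add: W_def card_PiE)
  let ?A = "W ({..<k} - {0})" and ?B = "W ({..<k} - {1})"
  \<comment> \<open>Expressing avoidance through the range of \<open>z\<close> makes the two set
    identities below propositional.\<close>
  have W_Diff: "z \<in> W ({..<k} - T) \<longleftrightarrow> z \<in> W {..<k} \<and> (\<forall>t\<in>T. t \<notin> z ` {..<k})" for z T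
    by (auto simp: W_def PiE_iff)
  have words: "mixed_words k = {z \<in> W {..<k}. 0 \<in> z ` {..<k} \<and> 1 \<in> z ` {..<k}}"
    by (simp add: mixed_words_def W_def)
  have eq: "mixed_words k = W {..<k} - (?A \<union> ?B)"
    unfolding words
    by (rule set_eqI) (simp only: mem_Collect_eq Diff_iff Un_iff W_Diff ball_simps simp_thms, argo)
  have sub: "?A \<union> ?B \<subseteq> W {..<k}"
    by (simp add: subset_iff W_Diff)
  have int: "?A \<inter> ?B = W ({..<k} - {0, 1})"
    by (rule set_eqI) (simp only: Int_iff W_Diff ball_simps simp_thms, argo)
  have "real (card (?A \<union> ?B)) + real (card (?A \<inter> ?B)) = real (card ?A) + real (card ?B)"
    by (metis card_Un_Int fin finite_Diff finite_lessThan of_nat_add)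
  moreover have "real (card (mixed_words k)) = real (card (W {..<k})) - real (card (?A \<union> ?B))"
  proof -
    have "card (mixed_words k) = card (W {..<k}) - card (?A \<union> ?B)"
      unfolding eq by (rule card_Diff_subset[OF _ sub]) (simp add: fin)
    moreover have "card (?A \<union> ?B) \<le> card (W {..<k})"
      by (rule card_mono[OF _ sub]) (simp add: fin)
    ultimately show ?thesis by (simp add: of_nat_diff)
  qed
  moreover have "card ({..<k} - {0}) = k - 1" "card ({..<k} - {1}) = k - 1"
    "card ({..<k} - {0, 1}) = k - 2"
    using assms by (auto simp: card_Diff_subset)
  ultimately show ?thesis
    using assms unfolding int card_W by simp
qed

text \<open>There are \<open>k\<close> choices of \<open>i\<close>, and for each
  \<open>k - 2\<close> free positions with \<open>k - 2\<close> values.\<close>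

lemma card_double_sets_le:
  assumes "2 \<le> k"
  shows "finite (double_sets k) \<and> card (double_sets k) \<le> k * (k - 2) ^ (k - 2)"
proof
  have fin: "finite (rest k i)" for i by (simp add: rest_def)
  then show "finite (double_sets k)"
    by (auto simp: double_sets_def intro!: finite_PiE)
  have "card (double_sets k) \<le> (\<Sum>i<k. card (rest k i \<rightarrow>\<^sub>E {2..<k}))"
    unfolding double_sets_def
    by (intro order_trans[OF card_UN_le] sum_mono card_image_le finite_PiE fin) auto
  also have "\<dots> = (\<Sum>i<k. (k - 2) ^ (k - 2))"
    using assms by (intro sum.cong) (auto simp: card_PiE fin card_rest)
  finally show "card (double_sets k) \<le> k * (k - 2) ^ (k - 2)" by simp
qed

section \<open>Every choice from the left lists contains a listed set\<close>

lemma transversal_contains_set: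
  assumes k: "2 \<le> k" and f: "\<And>i. i < k + 2 \<Longrightarrow> f i \<in> left_list k i"
  shows "\<exists>S \<in> mixed_sets k \<union> double_sets k. S \<subseteq> f ` {..<k + 2}"
proof -
  have "\<exists>t<k. f l = color l t" if "l < k" for l
    using f[of l] that by (auto simp: left_list_def)
  then obtain z where z: "\<And>l. l < k \<Longrightarrow> z l < k \<and> f l = color l (z l)"
    by metis
  obtain i where i: "i < k" "f k = color i 0"
    using f[of k] by (auto simp: left_list_def)
  obtain j where j: "j < k" "f (k + 1) = color j 1"
    using f[of "k + 1"] by (auto simp: left_list_def)
  have in_f: "color i 0 \<in> f ` {..<k + 2}" "color j 1 \<in> f ` {..<k + 2}"
    "\<And>l. l < k \<Longrightarrow> color l (z l) \<in> f ` {..<k + 2}"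
  proof -
    have f_in: "f l \<in> f ` {..<k + 2}" if "l < k + 2" for l
      using that by simp
    show "color i 0 \<in> f ` {..<k + 2}"
      using f_in[of k] unfolding i(2) by simp
    show "color j 1 \<in> f ` {..<k + 2}"
      using f_in[of "k + 1"] unfolding j(2) by simp
    show "color l (z l) \<in> f ` {..<k + 2}" if "l < k" for l
      using f_in[of l] z[OF that] that by simp
  qed
  \<comment> \<open>The word \<open>u\<close> may replace \<open>z\<close> by 0 at \<open>i\<close>
    and by 1 at \<open>j\<close>, as these colors are used by the two extra vertices.\<close>
  have mixed: ?thesis
    if u: "\<And>l. l < k \<Longrightarrow> u l = z l \<or> l = i \<and> u l = 0 \<or> l = j \<and> u l = 1"
      and "a < k" "u a = 0" "b < k" "u b = 1" for u a b
  proof -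
    let ?v = "restrict u {..<k}"
    have "?v \<in> mixed_words k"
      using u z k that(2-5) unfolding mixed_words_def by (force simp: image_iff)
    then have "(\<lambda>l. color l (?v l)) ` {..<k} \<in> mixed_sets k"
      unfolding mixed_sets_def by (rule imageI)
    moreover have "(\<lambda>l. color l (?v l)) ` {..<k} \<subseteq> f ` {..<k + 2}"
    proof (rule image_subsetI)
      fix l assume "l \<in> {..<k}"
      then have l: "l < k" by simp
      then have "color l (?v l) = color l (u l)" by simp
      also have "\<dots> \<in> f ` {..<k + 2}"
        using u[OF l] in_f(1,2) in_f(3)[OF l] by (elim disjE conjE; simp only:)
      finally show "color l (?v l) \<in> f ` {..<k + 2}" .
    qed
    ultimately show ?thesis by blast
  qed
  \<comment> \<open>If \<open>i = j\<close>, only one of the two replacements is possible, so the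
    other value must already occur in \<open>z\<close> at a different index. If neither does,
    \<open>z\<close> takes only values from 2 on outside \<open>i\<close>.\<close>
  consider "i \<noteq> j" | l where "i = j" "l < k" "l \<noteq> i" "z l = 0"
    | l where "i = j" "l < k" "l \<noteq> i" "z l = 1"
    | "i = j" "\<And>l. l < k \<Longrightarrow> l \<noteq> i \<Longrightarrow> z l \<noteq> 0 \<and> z l \<noteq> 1"
    by metis
  then show ?thesis
  proof cases
    case 1
    show ?thesis
      by (rule mixed[of "z(i := 0, j := 1)" i j]) (use 1 i j in auto)
  next
    case (2 l)
    show ?thesis
      by (rule mixed[of "z(j := 1)" l j]) (use 2 i j in auto)
  next
    case (3 l)
    show ?thesis
      by (rule mixed[of "z(i := 0)" i l]) (use 3 i j in auto)
  next
    case 4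
    have rest: "l < k \<and> l \<noteq> i" if "l \<in> rest k i" for l
      using that by (auto simp: rest_def)
    let ?w = "restrict z (rest k i)"
    have "z l \<in> {2..<k}" if "l \<in> rest k i" for l
      using 4(2)[of l] z[of l] rest[OF that] by auto
    then have "?w \<in> rest k i \<rightarrow>\<^sub>E {2..<k}" by auto
    then have "{color i 0, color i 1} \<union> (\<lambda>l. color l (?w l)) ` rest k i \<in> double_sets k"
      using i unfolding double_sets_def by blast
    moreover have "{color i 0, color i 1} \<union> (\<lambda>l. color l (?w l)) ` rest k i \<subseteq> f ` {..<k + 2}"
      using in_f rest 4(1) by auto
    ultimately show ?thesis by blast
  qed
qed

section \<open>The explicit bound and its asymptotics\<close>

lemma n_min_upper_bound:
  assumes "2 \<le> k"
  shows "real (n_min (k + 2)) \<le>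
    real k ^ k - 2 * (real k - 1) ^ k + (real k - 2) ^ k + real k * (real k - 2) ^ (k - 2)"
proof -
  let ?F = "mixed_sets k \<union> double_sets k"
  have fin: "finite (mixed_sets k)"
    by (simp add: mixed_sets_def finite_mixed_words)
  have "\<not> choosable (complete_bipartite (k + 2) (card ?F)) k"
  proof (rule not_choosable_complete_bipartiteI)
    show "finite ?F" using fin card_double_sets_le[OF assms] by simp
    show "\<exists>S\<in>?F. S \<subseteq> f ` {..<k + 2}" if "\<And>i. i < k + 2 \<Longrightarrow> f i \<in> left_list k i" for f
      using transversal_contains_set[OF assms that] .
  qed (use assms card_mixed_set card_double_set card_left_list in auto)
  then have "n_min (k + 2) \<le> card ?F"
    using assms by (intro n_min_le) auto
  also have "\<dots> \<le> card (mixed_sets k) + card (double_sets k)"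
    by (rule card_Un_le)
  also have "\<dots> \<le> card (mixed_words k) + k * (k - 2) ^ (k - 2)"
    using card_double_sets_le[OF assms] unfolding mixed_sets_def
    by (intro add_mono card_image_le finite_mixed_words) auto
  finally have "real (n_min (k + 2)) \<le> real (card (mixed_words k) + k * (k - 2) ^ (k - 2))"
    by (rule of_nat_mono)
  then show ?thesis
    using assms card_mixed_words[OF assms] by simp
qed

lemma one_minus_inverse_exp_1_less: "(1 - exp (- 1)) ^ 2 < (0.4643 :: real)"
proof -
  have "exp (- 1 :: real) \<ge> 1 / 3"
    using exp_le by (simp add: exp_minus field_simps)
  moreover have "exp (- 1 :: real) \<le> 1" by simp
  ultimately have "(1 - exp (- 1 :: real)) ^ 2 \<le> (2 / 3) ^ 2"
    by (intro power_mono) auto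
  also have "\<dots> < (0.4643 :: real)" by (simp add: power2_eq_square)
  finally show ?thesis .
qed

text \<open>After division by \<open>real k ^ k\<close> the last term carries the factor
  \<open>real k / (real k - 2) ^ 2\<close>, which tends to 0; the others converge to the expansion
  of \<open>(1 - exp (- 1)) ^ 2\<close>.\<close>

lemma eventually_upper_bound_le:
  "eventually (\<lambda>k::nat. real k ^ k - 2 * (real k - 1) ^ k + (real k - 2) ^ k
     + real k * (real k - 2) ^ (k - 2) \<le> 0.4643 * real k ^ k) sequentially"
proof -
  have "(\<lambda>k::nat. 1 - 2 * (1 - 1 / real k) ^ k + (1 - 2 / real k) ^ k
      + real k / (real k - 2) ^ 2 * (1 - 2 / real k) ^ k) \<longlonglongrightarrow> 1 - 2 * exp (- 1) + exp (- 2)"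
    by real_asymp
  moreover have "1 - 2 * exp (- 1) + exp (- 2) < (0.4643 :: real)"
    using one_minus_inverse_exp_1_less
    by (simp add: power2_eq_square algebra_simps flip: exp_add)
  ultimately have "eventually (\<lambda>k::nat. 1 - 2 * (1 - 1 / real k) ^ k + (1 - 2 / real k) ^ k
      + real k / (real k - 2) ^ 2 * (1 - 2 / real k) ^ k < 0.4643) sequentially"
    by (rule order_tendstoD(2))
  \<comment> \<open>From 3 on, \<open>real k - 2\<close> is positive and can be divided by.\<close>
  with eventually_ge_at_top[of 3] show ?thesis
  proof eventually_elim
    case (elim k)
    then have k: "real k > 0" "real k - 2 > 0" by auto
    have 1: "(1 - 1 / real k) ^ k * real k ^ k = (real k - 1) ^ k"
      using k by (simp add: left_diff_distrib flip: power_mult_distrib)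
    have 2: "(1 - 2 / real k) ^ k * real k ^ k = (real k - 2) ^ k"
      using k by (simp add: left_diff_distrib flip: power_mult_distrib)
    have "(real k - 2) ^ k = (real k - 2) ^ (k - 2) * (real k - 2) ^ 2"
      by (metis elim(1) power_add le_add_diff_inverse2 numeral_2_eq_2 numeral_3_eq_3 Suc_leD)
    then have 3: "(real k - 2) ^ k / (real k - 2) ^ 2 = (real k - 2) ^ (k - 2)"
      using k by simp
    have "(1 - 2 * (1 - 1 / real k) ^ k + (1 - 2 / real k) ^ k
        + real k / (real k - 2) ^ 2 * (1 - 2 / real k) ^ k) * real k ^ k \<le> 0.4643 * real k ^ k"
      using elim(2) by (intro mult_right_mono) auto
    also have "(1 - 2 * (1 - 1 / real k) ^ k + (1 - 2 / real k) ^ k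
        + real k / (real k - 2) ^ 2 * (1 - 2 / real k) ^ k) * real k ^ k
      = real k ^ k - 2 * ((1 - 1 / real k) ^ k * real k ^ k) + (1 - 2 / real k) ^ k * real k ^ k
        + real k * ((1 - 2 / real k) ^ k * real k ^ k / (real k - 2) ^ 2)"
      by (simp add: ring_distribs)
    finally show ?case unfolding 1 2 3 .
  qed
qed

theorem theorem2:
  "\<exists>S :: nat set. infinite S \<and>
     (\<forall>m\<in>S. 3 \<le> m \<and> real (n_min m) \<le> 0.4643 * (real m - 2) ^ (m - 2))"
proof -
  obtain K where K: "\<And>k. k \<ge> K \<Longrightarrow> real k ^ k - 2 * (real k - 1) ^ k + (real k - 2) ^ k
     + real k * (real k - 2) ^ (k - 2) \<le> 0.4643 * real k ^ k"
    using eventually_upper_bound_le unfolding eventually_sequentially by blast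
  \<comment> \<open>Starting at \<open>K + 4\<close> ensures both \<open>k \<ge> K\<close> and
    \<open>k \<ge> 2\<close> for \<open>k = m - 2\<close>.\<close>
  have "3 \<le> m \<and> real (n_min m) \<le> 0.4643 * (real m - 2) ^ (m - 2)" if "m \<in> {K + 4..}" for m
  proof -
    obtain k where k: "m = k + 2" "k \<ge> K" "k \<ge> 2"
      using \<open>m \<in> {K + 4..}\<close> by (intro that[of "m - 2"]) auto
    then show ?thesis
      using order_trans[OF n_min_upper_bound K] by simp
  qed
  then show ?thesis
    by (intro exI[of _ "{K + 4..}"]) (use infinite_Ici in blast)
qed

end
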